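(* Let $A\subseteq B\subseteq[n]$, and let $h:\mathbb{Z}_+^B\to\{0,1\}$ be measurable with respect to the coordinates in $A$ (i.e. $h(\mathbf{a})$ depends only on the coordinates of $\mathbf{a}$ in $A$). Let $\mathbf{Z}_B$ and $\mathbf{C}_B$ be arbitrary random processes with values in $\mathbb{Z}_+^B$, and let $\mathbf{Z}_A$ and $\mathbf{C}_A$ denote their respective restrictions to coordinates in $A$. Let $$\mathbf{C}_B^*\stackrel{d}{=}(\mathbf{C}_B\mid h(\mathbf{C}_B)=1),\qquad \mathbf{Z}_B^*\stackrel{d}{=}(\mathbf{Z}_B\mid h(\mathbf{Z}_B)=1).$$ Write $p=\mathbb{P}(h(\mathbf{Z}_B)=1)$, $q=\mathbb{P}(h(\mathbf{C}_B)=1)$, $d_B=d_{TV}(\mathbf{C}_B,\mathbf{Z}_B)$, $d_A=d_{TV}(\mathbf{C}_A,\mathbf{Z}_A)$, and assume that $p>0$ and $q>0$. Then $$d_{TV}(\mathbf{C}_B^*,\mathbf{Z}_B^* )\ \le\ \frac12\left|1-\frac qp\right|+\frac{d_B}{p}\ \le\ \frac1p\left(\frac{d_A}{2}+d_B\right)\ \le\ \frac32\,\frac{d_B}{p}.$$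
   Context: $[n]=\{1,\ldots,n\}$, $\mathbb{Z}_+=\{0,1,2,\ldots\}$. For random elements $X,Y$ of a countable set $S$, $d_{TV}(X,Y)=\frac12\sum_{s\in S}|\mathbb{P}(X=s)-\mathbb{P}(Y=s)|$. $\stackrel{d}{=}$ denotes equality in distribution and $(X\mid E)$ the conditional distribution of $X$ given the event $E$. *)

theory Defs
  imports "HOL-Probability.Probability"
begin

text \<open>The index set is a set of naturals; functions outside it are pinned to
  \<^term>\<open>undefined\<close>, so that for finite \<open>I\<close> this set is countable, and
  \<^term>\<open>restrict a J\<close> is the projection of \<open>a\<close> to the coordinates in \<open>J\<close>.\<close>

definition nat_vectors :: "nat set \<Rightarrow> (nat \<Rightarrow> nat) set" where
  "nat_vectors I = I \<rightarrow>\<^sub>E UNIV"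

text \<open>The two random elements of the countable set \<open>S\<close> may live on different
  probability spaces.\<close>

definition d_TV ::
    "'s set \<Rightarrow> 'a measure \<Rightarrow> ('a \<Rightarrow> 's) \<Rightarrow> 'b measure \<Rightarrow> ('b \<Rightarrow> 's) \<Rightarrow> real" where
  "d_TV S M X N Y =
     1 / 2 * (\<Sum>\<^sub>\<infinity>s\<in>S. \<bar>\<P>(\<omega> in M. X \<omega> = s) - \<P>(\<omega> in N. Y \<omega> = s)\<bar>)"

definition eq_in_distr ::
    "'s set \<Rightarrow> 'a measure \<Rightarrow> ('a \<Rightarrow> 's) \<Rightarrow> 'b measure \<Rightarrow> ('b \<Rightarrow> 's) \<Rightarrow> bool" where
  "eq_in_distr S M X N Y \<longleftrightarrow> distr M (count_space S) X = distr N (count_space S) Y"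

text \<open>\<^term>\<open>uniform_measure M E\<close> is \<open>M\<close> conditioned on the event \<open>E\<close>, that is,
  \<open>F \<mapsto> M (E \<inter> F) / M E\<close>; hence the law of \<open>X\<close> under it is the law of \<open>(X | E)\<close>.\<close>

definition eq_in_distr_cond ::
    "'s set \<Rightarrow> 'a measure \<Rightarrow> ('a \<Rightarrow> 's) \<Rightarrow> 'b measure \<Rightarrow> ('b \<Rightarrow> 's) \<Rightarrow> 'b set \<Rightarrow> bool" where
  "eq_in_distr_cond S M X N Y E \<longleftrightarrow> eq_in_distr S M X (uniform_measure N E) Y"

text \<open>Here \<open>h\<close> is a function on \<^term>\<open>nat_vectors B\<close>; its values elsewhere are irrelevant.\<close>

definition depends_only_on ::
    "nat set \<Rightarrow> nat set \<Rightarrow> ((nat \<Rightarrow> nat) \<Rightarrow> 'b) \<Rightarrow> bool" where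
  "depends_only_on A B h \<longleftrightarrow>
     (\<forall>a\<in>nat_vectors B. \<forall>b\<in>nat_vectors B. (\<forall>i\<in>A. a i = b i) \<longrightarrow> h a = h b)"

end

theory Submission
  imports Defs
begin

text \<open>The first inequality is a triangle inequality on the event \<open>h = 1\<close>: there
  \<open>|c/q - z/p| \<le> c |1/q - 1/p| + |c - z| / p\<close>, and the masses \<open>c\<close> sum to \<open>q\<close>.
  The other two use that the total variation distance is the largest difference of the
  probabilities of an event. As \<open>h = 1\<close> is an event about the coordinates in \<open>A\<close>, this gives
  \<open>|p - q| \<le> d_A\<close>; as the distance \<open>d_A\<close> is attained by an event, which pulls back
  along the projection, it also gives \<open>d_A \<le> d_B\<close>.\<close>

section \<open>Events and point masses of a random element of a countable set\<close>

lemma countable_nat_vectors: "finite I \<Longrightarrow> countable (nat_vectors I)"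
  unfolding nat_vectors_def by (rule countable_PiE) auto

text \<open>Every subset of \<open>S\<close> is measurable in \<open>count_space S\<close>, and
  \<open>X\<close> takes its values in \<open>S\<close>, so intersecting \<open>P\<close> with
  \<open>S\<close> leaves the event unchanged.\<close>

lemma measurable_pred_count_space:
  assumes "X \<in> M \<rightarrow>\<^sub>M count_space S"
  shows "{\<omega> \<in> space M. P (X \<omega>)} \<in> sets M"
proof -
  have "{\<omega> \<in> space M. P (X \<omega>)} = X -` {s \<in> S. P s} \<inter> space M"
    using measurable_space[OF assms] by auto
  also have "\<dots> \<in> sets M"
    using assms by (rule measurable_sets) auto
  finally show ?thesis .
qed

text \<open>Countable additivity over the disjoint fibres of \<open>X\<close>. The sum first arises
  as an integral against the counting measure, and finiteness of that integral gives the absolute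
  summability needed to pass to \<open>has_sum\<close>.\<close>

lemma (in prob_space) has_sum_prob:
  assumes "X \<in> M \<rightarrow>\<^sub>M count_space S" and "countable S" and "E \<subseteq> S"
  shows "((\<lambda>s. \<P>(\<omega> in M. X \<omega> = s)) has_sum \<P>(\<omega> in M. X \<omega> \<in> E)) E"
proof -
  let ?f = "\<lambda>s. \<P>(\<omega> in M. X \<omega> = s)"
  have "{\<omega> \<in> space M. X \<omega> \<in> E} = (\<Union>s\<in>E. {\<omega> \<in> space M. X \<omega> = s})"
    by auto
  moreover have "emeasure M (\<Union>s\<in>E. {\<omega> \<in> space M. X \<omega> = s}) =
      (\<integral>\<^sup>+s. emeasure M {\<omega> \<in> space M. X \<omega> = s} \<partial>count_space E)"
    using assms by (intro emeasure_UN_countable measurable_pred_count_space[OF assms(1)])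
      (auto simp: disjoint_family_on_def intro: countable_subset)
  ultimately have nn: "(\<integral>\<^sup>+s. ennreal (?f s) \<partial>count_space E) = ennreal \<P>(\<omega> in M. X \<omega> \<in> E)"
    by (simp add: emeasure_eq_measure)
  then have int: "integrable (count_space E) ?f"
    by (intro integrableI_nonneg) auto
  then have "integral\<^sup>L (count_space E) ?f = \<P>(\<omega> in M. X \<omega> \<in> E)"
    by (subst integral_eq_nn_integral) (auto simp: nn)
  then have "infsetsum ?f E = \<P>(\<omega> in M. X \<omega> \<in> E)"
    by (simp add: infsetsum_def)
  moreover have summ: "Infinite_Set_Sum.abs_summable_on ?f E"
    using int by (simp add: Infinite_Set_Sum.abs_summable_on_def)
  moreover have "?f summable_on E"
    by (rule abs_summable_summable[OF iffD2[OF abs_summable_equivalent summ]])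
  ultimately show ?thesis
    using has_sum_infsum[of ?f E] unfolding infsetsum_infsum[OF summ] by metis
qed

section \<open>Total variation distance and probabilities of events\<close>

context
  fixes M :: "'a measure" and N :: "'b measure" and X :: "'a \<Rightarrow> 's" and Y :: "'b \<Rightarrow> 's"
    and S :: "'s set"
  assumes M: "prob_space M" and N: "prob_space N"
    and X: "X \<in> M \<rightarrow>\<^sub>M count_space S" and Y: "Y \<in> N \<rightarrow>\<^sub>M count_space S"
    and S: "countable S"
begin

lemma has_sum_diff_prob:
  assumes "E \<subseteq> S"
  shows "((\<lambda>s. \<P>(\<omega> in M. X \<omega> = s) - \<P>(\<omega> in N. Y \<omega> = s)) has_sum
      (\<P>(\<omega> in M. X \<omega> \<in> E) - \<P>(\<omega> in N. Y \<omega> \<in> E))) E"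
  using has_sum_add[OF prob_space.has_sum_prob[OF M X S assms]
      has_sum_uminusI[OF prob_space.has_sum_prob[OF N Y S assms]]] by simp

lemma abs_diff_prob_summable:
  assumes "E \<subseteq> S"
  shows "(\<lambda>s. \<bar>\<P>(\<omega> in M. X \<omega> = s) - \<P>(\<omega> in N. Y \<omega> = s)\<bar>) summable_on E"
  using has_sum_diff_prob[OF assms, THEN has_sum_imp_summable,
      THEN summable_on_iff_abs_summable_on_real[THEN iffD1]] by simp

lemma has_sum_two_d_TV:
  "((\<lambda>s. \<bar>\<P>(\<omega> in M. X \<omega> = s) - \<P>(\<omega> in N. Y \<omega> = s)\<bar>) has_sum (2 * d_TV S M X N Y)) S"
  using has_sum_infsum[OF abs_diff_prob_summable[OF subset_refl]] by (simp add: d_TV_def)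

text \<open>Both laws have total mass 1 on \<open>S\<close>, so passing to the complement flips the
  sign of the difference.\<close>

lemma diff_prob_Compl:
  assumes "E \<subseteq> S"
  shows "\<P>(\<omega> in M. X \<omega> \<in> S - E) - \<P>(\<omega> in N. Y \<omega> \<in> S - E) =
      \<P>(\<omega> in N. Y \<omega> \<in> E) - \<P>(\<omega> in M. X \<omega> \<in> E)"
proof -
  have eq: "\<P>(\<omega> in L. W \<omega> \<in> S - E) = 1 - \<P>(\<omega> in L. W \<omega> \<in> E)"
    if "prob_space L" and W: "W \<in> L \<rightarrow>\<^sub>M count_space S" for L and W :: "_ \<Rightarrow> 's"
  proof -
    interpret prob_space L by fact
    have "{\<omega> \<in> space L. W \<omega> \<in> S - E} = {\<omega> \<in> space L. \<not> W \<omega> \<in> E}"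
      using measurable_space[OF W] by auto
    then show ?thesis
      by (simp only: prob_neg[OF measurable_pred_count_space[OF W, of "\<lambda>s. s \<in> E"]])
  qed
  show ?thesis
    unfolding eq[OF M X] eq[OF N Y] by simp
qed

text \<open>The signed differences sum to \<open>?D\<close> over \<open>E\<close> and to
  \<open>- ?D\<close> over \<open>S - E\<close>. Each of the two sums of absolute values is
  therefore at least \<open>\<bar>?D\<bar>\<close>, and the factor 1/2 in \<open>d_TV\<close>
  absorbs the doubling.\<close>

lemma abs_diff_prob_le_d_TV:
  assumes "E \<subseteq> S"
  shows "\<bar>\<P>(\<omega> in M. X \<omega> \<in> E) - \<P>(\<omega> in N. Y \<omega> \<in> E)\<bar> \<le> d_TV S M X N Y"
proof -
  let ?d = "\<lambda>s. \<P>(\<omega> in M. X \<omega> = s) - \<P>(\<omega> in N. Y \<omega> = s)"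
  let ?D = "\<P>(\<omega> in M. X \<omega> \<in> E) - \<P>(\<omega> in N. Y \<omega> \<in> E)"
  have E': "S - E \<subseteq> S" by auto
  have 1: "(?d has_sum ?D) E"
    by (rule has_sum_diff_prob[OF assms])
  have 2: "(?d has_sum - ?D) (S - E)"
    using has_sum_diff_prob[OF E'] unfolding diff_prob_Compl[OF assms] by simp
  have s: "(\<lambda>s. \<bar>?d s\<bar>) summable_on E" "(\<lambda>s. \<bar>?d s\<bar>) summable_on (S - E)"
    using abs_diff_prob_summable assms E' by blast+
  have "\<bar>?D\<bar> \<le> (\<Sum>\<^sub>\<infinity>s\<in>E. \<bar>?d s\<bar>)"
    using norm_infsum_bound[of ?d E] s infsumI[OF 1] by simp
  moreover have "\<bar>?D\<bar> \<le> (\<Sum>\<^sub>\<infinity>s\<in>S - E. \<bar>?d s\<bar>)"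
    using norm_infsum_bound[of ?d "S - E"] s infsumI[OF 2] by simp
  moreover have "(\<Sum>\<^sub>\<infinity>s\<in>E. \<bar>?d s\<bar>) + (\<Sum>\<^sub>\<infinity>s\<in>S - E. \<bar>?d s\<bar>) = (\<Sum>\<^sub>\<infinity>s\<in>E \<union> (S - E). \<bar>?d s\<bar>)"
    using s by (intro infsum_Un_disjoint[symmetric]) auto
  moreover have "E \<union> (S - E) = S"
    using assms by auto
  ultimately show ?thesis
    by (simp add: d_TV_def)
qed

text \<open>The mass differences over \<open>S\<close> sum to zero, so \<^term>\<open>d_TV\<close> is the sum of the
  positive ones.\<close>

lemma d_TV_attained:
  obtains E where "E \<subseteq> S"
    and "d_TV S M X N Y = \<P>(\<omega> in M. X \<omega> \<in> E) - \<P>(\<omega> in N. Y \<omega> \<in> E)"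
proof
  let ?d = "\<lambda>s. \<P>(\<omega> in M. X \<omega> = s) - \<P>(\<omega> in N. Y \<omega> = s)"
  let ?E = "{s \<in> S. ?d s > 0}"
  let ?D = "\<P>(\<omega> in M. X \<omega> \<in> ?E) - \<P>(\<omega> in N. Y \<omega> \<in> ?E)"
  show E: "?E \<subseteq> S" by auto
  have 1: "((\<lambda>s. \<bar>?d s\<bar>) has_sum ?D) ?E"
    using has_sum_diff_prob[OF E] by (rule has_sum_cong[THEN iffD1, rotated]) auto
  \<comment> \<open>Off \<open>?E\<close> no difference is positive, so negating this sum turns it
    into a sum of absolute values, again equal to \<open>?D\<close>.\<close>
  have "(?d has_sum - ?D) (S - ?E)"
    using has_sum_diff_prob[of "S - ?E"] unfolding diff_prob_Compl[OF E] by auto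
  then have "((\<lambda>s. - ?d s) has_sum ?D) (S - ?E)"
    unfolding has_sum_uminus .
  then have 2: "((\<lambda>s. \<bar>?d s\<bar>) has_sum ?D) (S - ?E)"
    by (rule has_sum_cong[THEN iffD1, rotated]) auto
  have "((\<lambda>s. \<bar>?d s\<bar>) has_sum (?D + ?D)) (?E \<union> (S - ?E))"
    using 1 2 by (rule has_sum_Un_disjoint) auto
  moreover have "?E \<union> (S - ?E) = S"
    by auto
  ultimately show "d_TV S M X N Y = ?D"
    by (simp add: d_TV_def infsumI)
qed

end

text \<open>Applying a map cannot increase the distance: an event \<open>E\<close> attaining it in
  \<open>T\<close> has a preimage under \<open>f\<close> that competes in \<open>S\<close>.\<close>

lemma d_TV_map_le:
  assumes M: "prob_space M" and N: "prob_space N"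
    and X: "X \<in> M \<rightarrow>\<^sub>M count_space S" and Y: "Y \<in> N \<rightarrow>\<^sub>M count_space S"
    and S: "countable S" and f: "f \<in> S \<rightarrow> T" and T: "countable T"
  shows "d_TV T M (\<lambda>\<omega>. f (X \<omega>)) N (\<lambda>\<omega>. f (Y \<omega>)) \<le> d_TV S M X N Y"
proof -
  have f_meas: "f \<in> count_space S \<rightarrow>\<^sub>M count_space T"
    using f by simp
  obtain E where "d_TV T M (\<lambda>\<omega>. f (X \<omega>)) N (\<lambda>\<omega>. f (Y \<omega>)) =
      \<P>(\<omega> in M. f (X \<omega>) \<in> E) - \<P>(\<omega> in N. f (Y \<omega>) \<in> E)"
    using d_TV_attained[OF M N measurable_compose[OF X f_meas] measurable_compose[OF Y f_meas] T]
    by blast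
  moreover have "{\<omega> \<in> space M. f (X \<omega>) \<in> E} = {\<omega> \<in> space M. X \<omega> \<in> {s \<in> S. f s \<in> E}}"
    "{\<omega> \<in> space N. f (Y \<omega>) \<in> E} = {\<omega> \<in> space N. Y \<omega> \<in> {s \<in> S. f s \<in> E}}"
    using measurable_space[OF X] measurable_space[OF Y] by auto
  ultimately have "d_TV T M (\<lambda>\<omega>. f (X \<omega>)) N (\<lambda>\<omega>. f (Y \<omega>)) =
      \<P>(\<omega> in M. X \<omega> \<in> {s \<in> S. f s \<in> E}) - \<P>(\<omega> in N. Y \<omega> \<in> {s \<in> S. f s \<in> E})"
    by (simp only:)
  also have "\<dots> \<le> \<bar>\<dots>\<bar>"
    by (rule abs_ge_self)
  also have "\<dots> \<le> d_TV S M X N Y"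
    by (rule abs_diff_prob_le_d_TV[OF M N X Y S]) auto
  finally show ?thesis .
qed

section \<open>Conditioning on an event of positive probability\<close>

text \<open>Turns equality of laws into the point masses that \<open>d_TV\<close> is made of. On the
  fibre of \<open>s\<close> the conditioning event is everything or nothing, according to
  \<open>P s\<close>.\<close>

lemma prob_eq_in_distr_cond:
  assumes N: "prob_space N" and X: "X \<in> M \<rightarrow>\<^sub>M count_space S" and Y: "Y \<in> N \<rightarrow>\<^sub>M count_space S"
    and eq: "eq_in_distr_cond S M X N Y {\<omega> \<in> space N. P (Y \<omega>)}"
    and pos: "\<P>(\<omega> in N. P (Y \<omega>)) > 0" and s: "s \<in> S"
  shows "\<P>(\<omega> in M. X \<omega> = s) =
      (if P s then \<P>(\<omega> in N. Y \<omega> = s) / \<P>(\<omega> in N. P (Y \<omega>)) else 0)"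
proof -
  interpret N: prob_space N by fact
  let ?E = "{\<omega> \<in> space N. P (Y \<omega>)}"
  have Y': "Y \<in> uniform_measure N ?E \<rightarrow>\<^sub>M count_space S"
    using Y by (simp cong: measurable_cong_sets)
  have "\<P>(\<omega> in M. X \<omega> = s) = measure (distr M (count_space S) X) {s}"
    using s by (subst measure_distr[OF X]) (auto intro!: arg_cong[where f = "measure M"])
  also have "\<dots> = measure (uniform_measure N ?E) {\<omega> \<in> space N. Y \<omega> = s}"
    using eq s unfolding eq_in_distr_cond_def eq_in_distr_def
    by (simp add: measure_distr[OF Y'])
      (auto intro!: arg_cong[where f = "measure (uniform_measure N ?E)"])
  also have "\<dots> = measure N (?E \<inter> {\<omega> \<in> space N. Y \<omega> = s}) / measure N ?E"
    using pos by (intro measure_uniform_measure measurable_pred_count_space[OF Y])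
      (auto simp: N.emeasure_eq_measure)
  also have "?E \<inter> {\<omega> \<in> space N. Y \<omega> = s} = (if P s then {\<omega> \<in> space N. Y \<omega> = s} else {})"
    by auto
  finally show ?thesis
    by auto
qed

text \<open>This is the first inequality of the theorem, for a general predicate \<open>P\<close> in
  place of \<open>h = 1\<close>.\<close>

lemma d_TV_cond_le:
  assumes M: "prob_space M" and N: "prob_space N"
    and X: "X \<in> M \<rightarrow>\<^sub>M count_space S" and Y: "Y \<in> N \<rightarrow>\<^sub>M count_space S"
    and X': "X' \<in> M' \<rightarrow>\<^sub>M count_space S" and Y': "Y' \<in> N' \<rightarrow>\<^sub>M count_space S"
    and S: "countable S"
    and condX: "eq_in_distr_cond S M' X' M X {\<omega> \<in> space M. P (X \<omega>)}"
    and condY: "eq_in_distr_cond S N' Y' N Y {\<omega> \<in> space N. P (Y \<omega>)}"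
    and q_def: "q = \<P>(\<omega> in M. P (X \<omega>))" and p_def: "p = \<P>(\<omega> in N. P (Y \<omega>))"
    and pos: "q > 0" "p > 0"
  shows "d_TV S M' X' N' Y' \<le> 1 / 2 * \<bar>1 - q / p\<bar> + d_TV S M X N Y / p"
proof -
  let ?c = "\<lambda>s. \<P>(\<omega> in M. X \<omega> = s)" and ?z = "\<lambda>s. \<P>(\<omega> in N. Y \<omega> = s)"
  let ?c' = "\<lambda>s. \<P>(\<omega> in M'. X' \<omega> = s)" and ?z' = "\<lambda>s. \<P>(\<omega> in N'. Y' \<omega> = s)"
  let ?H = "{s \<in> S. P s}"
  have c': "?c' s = (if P s then ?c s / q else 0)" if "s \<in> S" for s
    using prob_eq_in_distr_cond[OF M X' X condX _ that] pos by (simp add: q_def)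
  have z': "?z' s = (if P s then ?z s / p else 0)" if "s \<in> S" for s
    using prob_eq_in_distr_cond[OF N Y' Y condY _ that] pos by (simp add: p_def)
  have "{\<omega> \<in> space M. X \<omega> \<in> ?H} = {\<omega> \<in> space M. P (X \<omega>)}"
    using measurable_space[OF X] by auto
  then have sum_c: "(?c has_sum q) ?H"
    using prob_space.has_sum_prob[OF M X S, of ?H] by (simp add: q_def)
  have sum_d: "(\<lambda>s. \<bar>?c s - ?z s\<bar>) summable_on ?H"
    by (rule abs_diff_prob_summable[OF M N X Y S]) auto
  \<comment> \<open>The summable majorant of the differences of conditional masses; its first part
    is evaluated exactly, since the masses \<open>?c\<close> sum to \<open>q\<close> over
    \<open>?H\<close>.\<close>
  have bound: "((\<lambda>s. \<bar>1 / q - 1 / p\<bar> * ?c s + 1 / p * \<bar>?c s - ?z s\<bar>) has_sum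
      (\<bar>1 / q - 1 / p\<bar> * q + 1 / p * (\<Sum>\<^sub>\<infinity>s\<in>?H. \<bar>?c s - ?z s\<bar>))) ?H"
    by (intro has_sum_add has_sum_cmult_right sum_c has_sum_infsum sum_d)
  have le: "\<bar>?c' s - ?z' s\<bar> \<le> \<bar>1 / q - 1 / p\<bar> * ?c s + 1 / p * \<bar>?c s - ?z s\<bar>" if "s \<in> ?H" for s
  proof -
    \<comment> \<open>Insert \<open>?c s / p\<close> between \<open>?c s / q\<close> and
      \<open>?z s / p\<close>.\<close>
    have "?c' s - ?z' s = (1 / q - 1 / p) * ?c s + 1 / p * (?c s - ?z s)"
      using that by (simp add: c' z' algebra_simps diff_divide_distrib)
    also have "\<bar>\<dots>\<bar> \<le> \<bar>(1 / q - 1 / p) * ?c s\<bar> + \<bar>1 / p * (?c s - ?z s)\<bar>"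
      by (rule abs_triangle_ineq)
    finally show ?thesis
      using pos by (simp add: abs_mult)
  qed
  have sum': "(\<lambda>s. \<bar>?c' s - ?z' s\<bar>) summable_on ?H"
    by (rule summable_on_comparison_test[OF has_sum_imp_summable[OF bound] le]) auto
  \<comment> \<open>Outside \<open>?H\<close> both conditional masses vanish.\<close>
  have "2 * d_TV S M' X' N' Y' = (\<Sum>\<^sub>\<infinity>s\<in>?H. \<bar>?c' s - ?z' s\<bar>)"
    unfolding d_TV_def by (simp, rule infsum_cong_neutral) (auto simp: c' z')
  also have "\<dots> \<le> \<bar>1 / q - 1 / p\<bar> * q + 1 / p * (\<Sum>\<^sub>\<infinity>s\<in>?H. \<bar>?c s - ?z s\<bar>)"
    by (rule has_sum_mono[OF has_sum_infsum[OF sum'] bound le])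
  \<comment> \<open>Enlarging \<open>?H\<close> to \<open>S\<close> only adds nonnegative
    terms.\<close>
  also have "(\<Sum>\<^sub>\<infinity>s\<in>?H. \<bar>?c s - ?z s\<bar>) \<le> 2 * d_TV S M X N Y"
    by (rule has_sum_mono2[OF has_sum_infsum[OF sum_d] has_sum_two_d_TV[OF M N X Y S]]) auto
  also have "\<bar>1 / q - 1 / p\<bar> * q = \<bar>(1 / q - 1 / p) * q\<bar>"
    using pos by (simp add: abs_mult)
  also have "(1 / q - 1 / p) * q = 1 - q / p"
    using pos by (simp add: field_simps)
  finally have "2 * d_TV S M' X' N' Y' \<le> \<bar>1 - q / p\<bar> + 1 / p * (2 * d_TV S M X N Y)"
    using pos by (simp add: divide_right_mono)
  then show ?thesis
    by simp
qed

theorem theorem6: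
  fixes n :: nat and A B :: "nat set"
    and h :: "(nat \<Rightarrow> nat) \<Rightarrow> nat"
    and MC :: "'a measure" and C :: "'a \<Rightarrow> nat \<Rightarrow> nat"
    and MZ :: "'b measure" and Z :: "'b \<Rightarrow> nat \<Rightarrow> nat"
    and MC' :: "'c measure" and C' :: "'c \<Rightarrow> nat \<Rightarrow> nat"
    and MZ' :: "'d measure" and Z' :: "'d \<Rightarrow> nat \<Rightarrow> nat"
    and p q d_A d_B :: real
  assumes "A \<subseteq> B" and "B \<subseteq> {1..n}"
    and "h \<in> nat_vectors B \<rightarrow> {0, 1}"
    and "depends_only_on A B h"
    and "prob_space MC" and "C \<in> MC \<rightarrow>\<^sub>M count_space (nat_vectors B)"
    and "prob_space MZ" and "Z \<in> MZ \<rightarrow>\<^sub>M count_space (nat_vectors B)"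
    and "prob_space MC'" and "C' \<in> MC' \<rightarrow>\<^sub>M count_space (nat_vectors B)"
    and "prob_space MZ'" and "Z' \<in> MZ' \<rightarrow>\<^sub>M count_space (nat_vectors B)"
    and "eq_in_distr_cond (nat_vectors B) MC' C' MC C {\<omega> \<in> space MC. h (C \<omega>) = 1}"
    and "eq_in_distr_cond (nat_vectors B) MZ' Z' MZ Z {\<omega> \<in> space MZ. h (Z \<omega>) = 1}"
    and "p = \<P>(\<omega> in MZ. h (Z \<omega>) = 1)"
    and "q = \<P>(\<omega> in MC. h (C \<omega>) = 1)"
    and "d_B = d_TV (nat_vectors B) MC C MZ Z"
    and "d_A = d_TV (nat_vectors A) MC (\<lambda>\<omega>. restrict (C \<omega>) A) MZ (\<lambda>\<omega>. restrict (Z \<omega>) A)"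
    and "p > 0" and "q > 0"
  shows "d_TV (nat_vectors B) MC' C' MZ' Z' \<le> 1 / 2 * \<bar>1 - q / p\<bar> + d_B / p
       \<and> 1 / 2 * \<bar>1 - q / p\<bar> + d_B / p \<le> 1 / p * (d_A / 2 + d_B)
       \<and> 1 / p * (d_A / 2 + d_B) \<le> 3 / 2 * (d_B / p)"
proof (intro conjI)
  let ?S = "nat_vectors B" and ?T = "nat_vectors A" and ?r = "\<lambda>a :: nat \<Rightarrow> nat. restrict a A"
  note MC = \<open>prob_space MC\<close> and MZ = \<open>prob_space MZ\<close>
    and C = \<open>C \<in> MC \<rightarrow>\<^sub>M count_space ?S\<close> and Z = \<open>Z \<in> MZ \<rightarrow>\<^sub>M count_space ?S\<close>
  have "finite B"
    using assms(2) by (rule finite_subset) simp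
  moreover from this have "finite A"
    using assms(1) by (rule rev_finite_subset)
  ultimately have S: "countable ?S" and T: "countable ?T"
    by (auto intro: countable_nat_vectors)
  have r: "?r \<in> ?S \<rightarrow> ?T"
    by (auto simp: nat_vectors_def)
  then have r_meas: "?r \<in> count_space ?S \<rightarrow>\<^sub>M count_space ?T"
    by simp
  have CA: "(\<lambda>\<omega>. ?r (C \<omega>)) \<in> MC \<rightarrow>\<^sub>M count_space ?T"
    and ZA: "(\<lambda>\<omega>. ?r (Z \<omega>)) \<in> MZ \<rightarrow>\<^sub>M count_space ?T"
    by (rule measurable_compose[OF C r_meas] measurable_compose[OF Z r_meas])+

  show "d_TV ?S MC' C' MZ' Z' \<le> 1 / 2 * \<bar>1 - q / p\<bar> + d_B / p"
    unfolding assms(17)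
    by (rule d_TV_cond_le[where P = "\<lambda>a. h a = 1", OF MC MZ C Z assms(10,12) S assms(13,14,16,15)])
      (use \<open>p > 0\<close> \<open>q > 0\<close> in auto)

  \<comment> \<open>The event \<open>h = 1\<close> seen from the coordinates in \<open>A\<close>.
    Since \<open>h\<close> depends on these alone, the preimage of this image under restriction is
    no larger than the original event, so its probabilities are \<open>q\<close> and
    \<open>p\<close>.\<close>
  let ?E = "?r ` {s \<in> ?S. h s = 1}"
  have h_iff: "?r s \<in> ?E \<longleftrightarrow> h s = 1" if "s \<in> ?S" for s
  proof
    assume "?r s \<in> ?E"
    then obtain t where t: "t \<in> ?S" "h t = 1" "?r s = ?r t"
      by auto
    then have "\<forall>i\<in>A. s i = t i"
      by (metis restrict_apply')
    then show "h s = 1"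
      using assms(4) that t unfolding depends_only_on_def by metis
  qed (use that in auto)
  have "{\<omega> \<in> space MC. ?r (C \<omega>) \<in> ?E} = {\<omega> \<in> space MC. h (C \<omega>) = 1}"
    using measurable_space[OF C] h_iff by auto
  moreover have "{\<omega> \<in> space MZ. ?r (Z \<omega>) \<in> ?E} = {\<omega> \<in> space MZ. h (Z \<omega>) = 1}"
    using measurable_space[OF Z] h_iff by auto
  moreover have "?E \<subseteq> ?T"
    using r by auto
  ultimately have "\<bar>q - p\<bar> \<le> d_A"
    using abs_diff_prob_le_d_TV[OF MC MZ CA ZA T, of ?E] assms(15,16,18) by simp
  \<comment> \<open>Dividing by \<open>p\<close> converts the bound on
    \<open>\<bar>q - p\<bar>\<close> into one on the first term of the middle expression.\<close>
  moreover have "\<bar>1 - q / p\<bar> = \<bar>q - p\<bar> / p"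
    using \<open>p > 0\<close> by (auto simp: abs_if field_simps)
  ultimately have "\<bar>1 - q / p\<bar> \<le> d_A / p"
    using \<open>p > 0\<close> by (simp add: divide_right_mono)
  then show "1 / 2 * \<bar>1 - q / p\<bar> + d_B / p \<le> 1 / p * (d_A / 2 + d_B)"
    by (simp add: distrib_left)

  \<comment> \<open>Restriction to \<open>A\<close> is a map from \<open>?S\<close> to
    \<open>?T\<close>; the constant 3/2 is then 1/2 from \<open>d_A / 2\<close> plus 1 from
    \<open>d_B\<close>.\<close>
  have "d_A \<le> d_B"
    using d_TV_map_le[OF MC MZ C Z S r T] assms(17,18) by simp
  then show "1 / p * (d_A / 2 + d_B) \<le> 3 / 2 * (d_B / p)"
    using \<open>p > 0\<close> by (simp add: field_simps)
qed

end
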